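(* Let $E_k(x)$ denote the $k$-th Euler polynomial. If $k$ is odd, then $E_k(x)$ is indecomposable (over $\mathbb{C}$). If $k=2m$ is even, then every nontrivial decomposition of $E_k(x)$ over the complex numbers is equivalent to $$E_k(x)=\widetilde{E}_m\left(\left(x-\tfrac{1}{2}\right)^{2}\right),\qquad \text{where } \widetilde{E}_m(x)=\sum_{j=0}^{m}\binom{2m}{2j}\frac{E_{2j}}{4^{j}}x^{m-j}.$$ In particular, the polynomial $\widetilde{E}_m(x)$ is indecomposable for every $m\in\mathbb{N}$.
   Context: The Euler polynomials $E_k(x)$ are defined by the generating function $\sum_{k=0}^{\infty}E_k(x)\frac{t^k}{k!}=\frac{2\exp(tx)}{\exp(t)+1}$. The $j$-th Euler number is $E_j=2^jE_j(1/2)$. For a field $K$ and $g,h\in K[x]$, $(g,h)$ is a decomposition of $f=g\circ h$ (functional composition); it is nontrivial if $\deg g\ge 2$ and $\deg h\ge 2$. A polynomial is indecomposable if it has degree at least $2$ and no nontrivial decomposition. Two decompositions $f=g_1\circ h_1=g_2\circ h_2$ are equivalent over $K$ if there is a linear polynomial $\ell\in K[x]$ with $g_2=g_1\circ\ell$ and $h_1=\ell\circ h_2$.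
   Formalization: The cases k = 1 (in the odd claim) and m = 0, 1 (in the claim on Ẽ_m) are excluded, since E_1, Ẽ_1 have degree 1 and Ẽ_0 has degree 0, while indecomposable requires degree at least 2. *)

theory Defs
  imports Complex_Main "HOL-Computational_Algebra.Computational_Algebra"
begin

text \<open>
  \<open>2 exp (t x) / (exp t + 1)\<close> as a formal power series in \<open>t\<close>, for a given complex number \<open>x\<close>.
  The constant term of the denominator is \<open>2\<close>, so the quotient is multiplication by the inverse.
\<close>

definition euler_gf :: "complex \<Rightarrow> complex fps" where
  "euler_gf x = fps_const 2 * fps_exp x / (fps_exp 1 + 1)"

text \<open>
  The polynomial whose value at every \<open>x\<close> is \<open>k!\<close> times the coefficient of \<open>t ^ k\<close>;
  existence and uniqueness are \<open>euler_poly_ex1\<close> below.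
\<close>

definition euler_poly :: "nat \<Rightarrow> complex poly" where
  "euler_poly k = (THE p. \<forall>x. poly p x = fact k * fps_nth (euler_gf x) k)"

lemma euler_poly_ex1: "\<exists>!p. \<forall>x. poly p x = fact k * fps_nth (euler_gf x) k"
proof (rule ex_ex1I)
  define c where "c = (inverse (fps_exp 1 + 1) :: complex fps)"
  define p where "p = (\<Sum>i=0..k. monom (fact k * (2 / fact i) * fps_nth c (k - i)) i)"
  have "poly p x = fact k * fps_nth (euler_gf x) k" for x
  proof -
    have "euler_gf x = fps_const 2 * (fps_exp x * c)"
      unfolding euler_gf_def c_def by (subst fps_divide_unit) (simp_all add: mult.assoc)
    then have "fps_nth (euler_gf x) k = 2 * (\<Sum>i=0..k. x ^ i / fact i * fps_nth c (k - i))"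
      by (simp only: fps_mult_left_const_nth) (simp add: fps_mult_nth)
    then show ?thesis
      by (simp add: p_def poly_sum poly_monom sum_distrib_left mult_ac)
  qed
  then show "\<exists>p. \<forall>x. poly p x = fact k * fps_nth (euler_gf x) k" by blast
next
  fix p q :: "complex poly"
  assume "\<forall>x. poly p x = fact k * fps_nth (euler_gf x) k"
    and "\<forall>x. poly q x = fact k * fps_nth (euler_gf x) k"
  then have "poly p = poly q" by auto
  then show "p = q" by (simp add: poly_eq_poly_eq_iff)
qed

lemma poly_euler_poly: "poly (euler_poly k) x = fact k * fps_nth (euler_gf x) k"
  using theI'[OF euler_poly_ex1, of k] unfolding euler_poly_def by blast

lemma euler_gf_eq: "euler_gf x = Abs_fps (\<lambda>k. poly (euler_poly k) x / fact k)"
  by (simp add: fps_eq_iff poly_euler_poly)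

definition euler_number :: "nat \<Rightarrow> complex" where
  "euler_number j = 2 ^ j * poly (euler_poly j) (1 / 2)"

definition euler_tilde :: "nat \<Rightarrow> complex poly" where
  "euler_tilde m =
     (\<Sum>j=0..m. monom (of_nat ((2 * m) choose (2 * j)) * (euler_number (2 * j) / 4 ^ j)) (m - j))"

definition is_decomposition :: "'a::field poly \<Rightarrow> 'a poly \<Rightarrow> 'a poly \<Rightarrow> bool" where
  "is_decomposition f g h \<longleftrightarrow> f = pcompose g h"

definition nontrivial_decomposition :: "'a::field poly \<Rightarrow> 'a poly \<Rightarrow> 'a poly \<Rightarrow> bool" where
  "nontrivial_decomposition f g h \<longleftrightarrow> is_decomposition f g h \<and> degree g \<ge> 2 \<and> degree h \<ge> 2"

definition indecomposable :: "'a::field poly \<Rightarrow> bool" where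
  "indecomposable f \<longleftrightarrow> degree f \<ge> 2 \<and> \<not> (\<exists>g h. nontrivial_decomposition f g h)"

definition equivalent_decompositions ::
    "'a::field poly \<times> 'a poly \<Rightarrow> 'a poly \<times> 'a poly \<Rightarrow> bool" where
  "equivalent_decompositions d1 d2 \<longleftrightarrow>
     (\<exists>l. degree l = 1 \<and> fst d2 = pcompose (fst d1) l \<and> snd d1 = pcompose l (snd d2))"

end

theory Submission
  imports Defs
begin

text \<open>
  Put \<open>f(y) = E\<^sub>k(y + 1/2)\<close>. From \<open>f(y + 1/2) + f(y - 1/2) = 2 y\<^sup>k\<close> one gets
  \<open>f(y + 1) - f(y - 1) = 2 (y + 1/2)\<^sup>k - 2 (y - 1/2)\<^sup>k\<close>, whose zeros all lie on the imaginary axis.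
  If \<open>f = g \<circ> h\<close> with \<open>deg g = n \<ge> 2\<close> and \<open>deg h = d \<ge> 3\<close>, every zero of
  \<open>D(y) = h(y + 1) - h(y - 1)\<close> is a zero of that difference, so the zeros of \<open>D\<close> are imaginary as
  well and the sum of their squares is nonpositive. The two leading nonzero coefficients of \<open>f\<close>
  determine those of \<open>h\<close>, hence those of \<open>D\<close>, and these give the value
  \<open>(d - 2) (3 n d - 4 d + 1) / 12 > 0\<close> for the sum of squares, a contradiction. Thus
  \<open>deg h = 2\<close>, and the vanishing of the coefficient of \<open>y\<^bsup>k - 1\<^esup>\<close> in \<open>f\<close> forces
  \<open>h = a y\<^sup>2 + c\<close>.
\<close>

section \<open>Leading coefficients of polynomials\<close>

text \<open>Newton's identity: with elementary symmetric functions \<open>e1\<close> and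
  \<open>e2\<close> of the \<open>r i\<close>, the coefficients are \<open>- e1\<close> and
  \<open>e2\<close>, and \<open>e1^2 - 2 * e2\<close> is the sum of squares. The constant
  coefficient enters the induction step.\<close>

lemma coeff_prod_linear_factors:
  fixes r :: "'b \<Rightarrow> 'a::comm_ring_1"
  assumes "finite A"
  defines "q \<equiv> \<Prod>i\<in>A. [:1, - r i:]"
  shows "coeff q 0 = 1" and "(coeff q 1)\<^sup>2 - 2 * coeff q 2 = (\<Sum>i\<in>A. (r i)\<^sup>2)"
proof -
  have "coeff q 0 = 1 \<and> (coeff q 1)\<^sup>2 - 2 * coeff q 2 = (\<Sum>i\<in>A. (r i)\<^sup>2)"
    unfolding q_def using assms(1)
  proof (induction A rule: finite_induct)
    case (insert x A)
    define p where "p = (\<Prod>i\<in>A. [:1, - r i:])"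
    have *: "(\<Prod>i\<in>insert x A. [:1, - r i:]) = p - smult (r x) (pCons 0 p)"
      using insert.hyps by (simp add: p_def)
    have IH: "coeff p 0 = 1" "(coeff p 1)\<^sup>2 - 2 * coeff p 2 = (\<Sum>i\<in>A. (r i)\<^sup>2)"
      using insert.IH by (simp_all add: p_def)
    have "(\<Sum>i\<in>insert x A. (r i)\<^sup>2) = (r x)\<^sup>2 + ((coeff p 1)\<^sup>2 - 2 * coeff p 2)"
      using insert.hyps IH(2) by simp
    then show ?case
      unfolding * using IH(1)
      by (simp add: coeff_pCons numeral_2_eq_2 power2_eq_square algebra_simps)
  qed auto
  then show "coeff q 0 = 1" and "(coeff q 1)\<^sup>2 - 2 * coeff q 2 = (\<Sum>i\<in>A. (r i)\<^sup>2)"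
    by blast+
qed

text \<open>Reversing \<open>p\<close> gives \<open>lead_coeff p\<close> times the product of the
  \<open>1 - r i * x\<close>. Since the roots sum to 0, the second symmetric function is minus half
  the sum of their squares, and squares of imaginary numbers are nonpositive.\<close>

lemma third_coeff_imaginary_roots:
  fixes p :: "complex poly"
  assumes roots: "\<And>z. poly p z = 0 \<Longrightarrow> Re z = 0"
    and deg: "degree p \<ge> 2"
    and second: "coeff p (degree p - 1) = 0"
  shows "\<exists>t\<ge>0. coeff p (degree p - 2) = lead_coeff p * of_real t"
proof -
  obtain r where r: "smult (lead_coeff p) (\<Prod>i<degree p. [:- r i, 1:]) = p"
    using complex_poly_decompose' .
  define q where "q = (\<Prod>i<degree p. [:1, - r i:])"
  have refl: "reflect_poly [:- x, 1:] = [:1, - x:]" for x :: complex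
    by (cases "x = 0") (simp_all add: reflect_poly_pCons' monom_altdef)
  have "reflect_poly p = smult (lead_coeff p) q"
    by (subst r [symmetric]) (simp add: reflect_poly_smult reflect_poly_prod refl q_def)
  then have q: "coeff p (degree p - i) = lead_coeff p * coeff q i" if "i \<le> degree p" for i
    using that by (metis coeff_reflect_poly coeff_smult not_le)
  have "coeff q 1 = 0"
    using q[of 1] second deg by auto
  then have "- 2 * coeff q 2 = (\<Sum>i<degree p. (r i)\<^sup>2)"
    using coeff_prod_linear_factors(2)[of "{..<degree p}" r] by (simp add: q_def)
  moreover have "(r i)\<^sup>2 = - of_real ((Im (r i))\<^sup>2)" if "i < degree p" for i
  proof -
    have "poly p (r i) = 0"
      by (subst r [symmetric]) (use that in \<open>auto simp: poly_prod\<close>)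
    then have "r i = \<i> * of_real (Im (r i))"
      using roots by (simp add: complex_eq_iff)
    then show ?thesis
      by (metis mult_minus1 of_real_power power2_i power_mult_distrib)
  qed
  ultimately have "- 2 * coeff q 2 = - of_real (\<Sum>i<degree p. (Im (r i))\<^sup>2)"
    by (simp add: sum_negf)
  then have "coeff q 2 = of_real ((\<Sum>i<degree p. (Im (r i))\<^sup>2) / 2)"
    by (simp add: field_simps)
  then show ?thesis
    using q[OF deg] by (intro exI[of _ "(\<Sum>i<degree p. (Im (r i))\<^sup>2) / 2"]) (simp add: sum_nonneg)
qed

section \<open>Top coefficients of powers, compositions and central differences\<close>

lemma coeff_power_low:
  fixes q :: "'a::comm_ring_1 poly"
  shows "coeff (q ^ n) 0 = coeff q 0 ^ n"
    and "coeff (q ^ n) 1 = of_nat n * coeff q 0 ^ (n - 1) * coeff q 1"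
    and "coeff q 1 = 0 \<Longrightarrow> coeff (q ^ n) 2 = of_nat n * coeff q 0 ^ (n - 1) * coeff q 2"
proof -
  show c0: "coeff (q ^ n) 0 = coeff q 0 ^ n" for n
    by (rule coeff_0_power)
  show c1: "coeff (q ^ n) 1 = of_nat n * coeff q 0 ^ (n - 1) * coeff q 1" for n
  proof (induction n)
    case (Suc n)
    then show ?case
      by (cases n) (simp_all add: coeff_mult c0 algebra_simps)
  qed simp
  show "coeff (q ^ n) 2 = of_nat n * coeff q 0 ^ (n - 1) * coeff q 2" if "coeff q 1 = 0"
  proof (induction n)
    case (Suc n)
    then show ?case
      using that by (cases n) (simp_all add: coeff_mult c0 numeral_2_eq_2 algebra_simps)
  qed simp
qed

text \<open>Reversal commutes with powers and turns top coefficients into low ones, so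
  \<open>coeff_power_low\<close> applies to \<open>reflect_poly h\<close>.\<close>

lemma coeff_power_high:
  fixes h :: "'a::idom poly"
  assumes "degree h \<ge> 2" and "n > 0"
  shows "coeff (h ^ n) (n * degree h - 1) =
      of_nat n * lead_coeff h ^ (n - 1) * coeff h (degree h - 1)"
    and "coeff h (degree h - 1) = 0 \<Longrightarrow> coeff (h ^ n) (n * degree h - 2) =
      of_nat n * lead_coeff h ^ (n - 1) * coeff h (degree h - 2)"
proof -
  have "n * degree h \<ge> 1 * 2"
    using assms by (intro mult_mono) auto
  then have ge: "n * degree h \<ge> 2" by simp
  have deg: "degree (h ^ n) = n * degree h"
    using assms by (subst degree_power_eq) auto
  have h1: "coeff (reflect_poly h) i = coeff h (degree h - i)" if "i \<le> 2" for i
    using that assms by (simp add: coeff_reflect_poly)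
  have h2: "coeff (h ^ n) (n * degree h - i) = coeff (reflect_poly h ^ n) i" if "i \<le> 2" for i
    using that ge by (simp add: reflect_poly_power [symmetric] coeff_reflect_poly deg)
  show "coeff (h ^ n) (n * degree h - 1) =
      of_nat n * lead_coeff h ^ (n - 1) * coeff h (degree h - 1)"
    using h2[of 1] h1[of 1] coeff_power_low(2)[of "reflect_poly h" n] by simp
  show "coeff (h ^ n) (n * degree h - 2) =
      of_nat n * lead_coeff h ^ (n - 1) * coeff h (degree h - 2)" if "coeff h (degree h - 1) = 0"
    using h2[of 2] h1[of 1] h1[of 2] that coeff_power_low(3)[of "reflect_poly h" n] by simp
qed

lemma pcompose_eq_sum:
  fixes p q :: "'a::comm_ring_1 poly"
  shows "pcompose p q = (\<Sum>j\<le>degree p. smult (coeff p j) (q ^ j))"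
  by (simp add: pcompose_altdef poly_altdef degree_map_poly coeff_map_poly)

text \<open>The powers \<open>h ^ j\<close> with \<open>j < degree g\<close> have degree at most
  \<open>(degree g - 1) * degree h\<close>, so only the leading term of \<open>g\<close> reaches
  index \<open>i\<close>.\<close>

lemma coeff_pcompose_high:
  fixes g h :: "'a::idom poly"
  assumes "i > (degree g - 1) * degree h"
  shows "coeff (pcompose g h) i = lead_coeff g * coeff (h ^ degree g) i"
proof -
  have "pcompose g h = (\<Sum>j\<le>degree g. smult (coeff g j) (h ^ j))"
    by (rule pcompose_eq_sum)
  also have "\<dots> = smult (lead_coeff g) (h ^ degree g) + (\<Sum>j<degree g. smult (coeff g j) (h ^ j))"
    by (simp add: lessThan_Suc_atMost [symmetric] add.commute)
  finally have "coeff (pcompose g h) i =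
      lead_coeff g * coeff (h ^ degree g) i + (\<Sum>j<degree g. coeff g j * coeff (h ^ j) i)"
    by (simp add: coeff_sum)
  moreover have "coeff (h ^ j) i = 0" if "j < degree g" for j
  proof (rule coeff_eq_0)
    have "degree (h ^ j) \<le> degree h * j"
      by (rule degree_power_le)
    also have "\<dots> \<le> (degree g - 1) * degree h"
      using that by (subst mult.commute) (intro mult_right_mono, auto)
    finally show "degree (h ^ j) < i"
      using assms by simp
  qed
  ultimately show ?thesis by simp
qed

lemma pcompose_cancel_right:
  fixes p q r :: "'a::idom poly"
  assumes "pcompose p r = pcompose q r" and "degree r > 0"
  shows "p = q"
proof -
  have "pcompose (p - q) r = 0"
    using assms(1) by (simp add: pcompose_diff)
  then show ?thesis
    using assms(2) by (simp add: pcompose_eq_0_iff)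
qed

lemma coeff_pcompose_shift:
  fixes h :: "'a::comm_ring_1 poly"
  shows "coeff (pcompose h [:c, 1:]) i =
    (\<Sum>j\<le>degree h. coeff h j * (of_nat (j choose i) * c ^ (j - i)))"
proof -
  have "pcompose h [:c, 1:] = (\<Sum>j\<le>degree h. smult (coeff h j) ([:c, 1:] ^ j))"
    by (rule pcompose_eq_sum)
  moreover have "coeff ([:c, 1:] ^ j) i = of_nat (j choose i) * c ^ (j - i)" for j
  proof (cases "i \<le> j")
    case True
    then show ?thesis
      by (simp add: coeff_linear_poly_power)
  next
    case False
    then show ?thesis
      by (simp add: coeff_eq_0 degree_linear_power binomial_eq_0)
  qed
  ultimately show ?thesis
    by (simp add: coeff_sum)
qed

text \<open>By the binomial theorem a term \<open>coeff h j\<close> contributes to index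
  \<open>i\<close> only if \<open>j - i\<close> is odd, and then with factor 2.\<close>

lemma coeff_central_difference:
  fixes h :: "'a::comm_ring_1 poly"
  assumes deg: "degree h = d + 3" and second: "coeff h (d + 2) = 0"
  defines "D \<equiv> pcompose h [:1, 1:] - pcompose h [:-1, 1:]"
  shows "i > d + 2 \<Longrightarrow> coeff D i = 0"
    and "coeff D (d + 2) = 2 * of_nat (d + 3) * lead_coeff h"
    and "coeff D (d + 1) = 0"
    and "coeff D d = 2 * of_nat ((d + 3) choose 3) * lead_coeff h
           + 2 * of_nat (d + 1) * coeff h (d + 1)"
proof -
  have D: "coeff D i = (\<Sum>j\<in>{i<..d + 3}. coeff h j * of_nat (j choose i) * (1 - (- 1) ^ (j - i)))"
    for i
  proof -
    have "coeff D i = (\<Sum>j\<le>d + 3. coeff h j * of_nat (j choose i) * (1 - (- 1) ^ (j - i)))"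
      by (simp add: D_def coeff_pcompose_shift deg sum_subtractf [symmetric] algebra_simps)
    also have "\<dots> = (\<Sum>j\<in>{i<..d + 3}. coeff h j * of_nat (j choose i) * (1 - (- 1) ^ (j - i)))"
      by (rule sum.mono_neutral_right) (auto simp: not_less)
    finally show ?thesis .
  qed
  show "coeff D i = 0" if "i > d + 2"
    using that by (simp add: D)
  have 1: "{d + 2<..d + 3} = {d + 3}" by auto
  have 2: "{d + 1<..d + 3} = {d + 2, d + 3}" by auto
  have 3: "{d<..d + 3} = {d + 1, d + 2, d + 3}" by auto
  show "coeff D (d + 2) = 2 * of_nat (d + 3) * lead_coeff h"
    using binomial_symmetric[of "d + 2" "d + 3"] by (simp only: D 1) (simp add: deg algebra_simps)
  show "coeff D (d + 1) = 0"
    using second by (simp only: D 2) simp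
  have "(d + 3) choose d = (d + 3) choose 3" "(d + 1) choose d = d + 1"
    using binomial_symmetric[of d "d + 3"] by auto
  then show "coeff D d = 2 * of_nat ((d + 3) choose 3) * lead_coeff h
      + 2 * of_nat (d + 1) * coeff h (d + 1)"
    by (simp only: D 3) (simp add: deg second algebra_simps)
qed

section \<open>Euler polynomials\<close>

lemma euler_gf_times_denominator: "euler_gf x * (fps_exp 1 + 1) = fps_const 2 * fps_exp x"
proof -
  have unit: "fps_nth (fps_exp 1 + 1 :: complex fps) 0 \<noteq> 0"
    by simp
  then have "euler_gf x * (fps_exp 1 + 1) =
      fps_const 2 * fps_exp x * (inverse (fps_exp 1 + 1) * (fps_exp 1 + 1))"
    unfolding euler_gf_def by (subst fps_divide_unit) (simp_all only: mult.assoc not_False_eq_True)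
  then show ?thesis
    by (simp only: inverse_mult_eq_1[OF unit] mult_1_right)
qed

lemma fps_exp_plus_one_neq_0: "fps_exp 1 + 1 \<noteq> (0 :: complex fps)"
proof
  assume "fps_exp 1 + 1 = (0 :: complex fps)"
  then have "fps_nth (fps_exp 1 + 1 :: complex fps) 0 = 0"
    by (simp only: fps_zero_nth)
  then show False by simp
qed

lemma euler_gf_add: "euler_gf (x + y) = fps_exp x * euler_gf y"
proof -
  have "euler_gf (x + y) * (fps_exp 1 + 1) = (fps_exp x * euler_gf y) * (fps_exp 1 + 1)"
    by (simp only: mult.assoc euler_gf_times_denominator fps_exp_add_mult)
      (simp only: mult_ac)
  then show ?thesis
    using fps_exp_plus_one_neq_0 by simp
qed

text \<open>Adding the series at \<open>x + 1\<close> and at \<open>x\<close> multiplies by exp(t) +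
  1, which cancels the denominator and leaves 2 exp(tx).\<close>

lemma euler_poly_functional_equation:
  "poly (euler_poly k) (x + 1) + poly (euler_poly k) x = 2 * x ^ k"
proof -
  have "euler_gf (x + 1) + euler_gf x = euler_gf x * (fps_exp 1 + 1)"
    by (simp add: add.commute[of x] euler_gf_add algebra_simps)
  then have "fps_nth (euler_gf (x + 1) + euler_gf x) k = 2 * (x ^ k / fact k)"
    by (simp add: euler_gf_times_denominator)
  then show ?thesis
    by (simp add: poly_euler_poly ring_distribs(1) [symmetric])
qed

section \<open>Euler polynomials centred at 1/2\<close>

definition centred_euler_poly :: "nat \<Rightarrow> complex poly" where
  "centred_euler_poly k = pcompose (euler_poly k) [:1 / 2, 1:]"

lemma poly_centred_euler_poly: "poly (centred_euler_poly k) y = poly (euler_poly k) (y + 1 / 2)"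
  by (simp add: centred_euler_poly_def poly_pcompose add.commute)

lemma centred_euler_poly_eq:
  "centred_euler_poly k = (\<Sum>i\<le>k. monom (of_nat (k choose i) * poly (euler_poly (k - i)) (1 / 2)) i)"
proof -
  have "poly (centred_euler_poly k) y =
      poly (\<Sum>i\<le>k. monom (of_nat (k choose i) * poly (euler_poly (k - i)) (1 / 2)) i) y" for y
  proof -
    have "poly (centred_euler_poly k) y =
        (\<Sum>i\<le>k. fact k * (y ^ i / fact i * fps_nth (euler_gf (1 / 2)) (k - i)))"
      by (simp add: poly_centred_euler_poly poly_euler_poly euler_gf_add fps_mult_nth
          sum_distrib_left atLeast0AtMost)
    also have "\<dots> = (\<Sum>i\<le>k. of_nat (k choose i) * poly (euler_poly (k - i)) (1 / 2) * y ^ i)"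
      by (intro sum.cong) (auto simp: poly_euler_poly binomial_fact field_simps)
    finally show ?thesis
      by (simp add: poly_sum poly_monom)
  qed
  then show ?thesis
    by (simp add: poly_eq_poly_eq_iff [symmetric] fun_eq_iff)
qed

lemma coeff_centred_euler_poly:
  "coeff (centred_euler_poly k) i =
    (if i \<le> k then of_nat (k choose i) * poly (euler_poly (k - i)) (1 / 2) else 0)"
  by (simp add: centred_euler_poly_eq coeff_sum)

text \<open>Dividing exp(t) + 1 by exp(t/2) makes the denominator symmetric: the series at 1/2 is 1
  / cosh(t/2).\<close>

lemma euler_gf_half_times_cosh:
  "euler_gf (1 / 2) * (fps_exp (1 / 2) + fps_exp (- 1 / 2)) = fps_const 2"
proof -
  have "fps_exp 1 + 1 = fps_exp (1 / 2) * (fps_exp (1 / 2) + fps_exp (- 1 / 2) :: complex fps)"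
    by (simp add: distrib_left fps_exp_add_mult [symmetric])
  then have "(euler_gf (1 / 2) * (fps_exp (1 / 2) + fps_exp (- 1 / 2))) * fps_exp (1 / 2) =
      fps_const 2 * fps_exp (1 / 2)"
    using euler_gf_times_denominator[of "1 / 2"] by (simp add: mult_ac)
  then show ?thesis by simp
qed

text \<open>The series 1 / cosh(t/2) is even in t. Formally, substituting -t fixes
  \<open>?C\<close>, so the series and its image have the same product with \<open>?C\<close>, which
  can be cancelled.\<close>

lemma euler_poly_half_odd:
  assumes "odd j"
  shows "poly (euler_poly j) (1 / 2) = 0"
proof -
  let ?C = "fps_exp (1 / 2) + fps_exp (- 1 / 2) :: complex fps"
  have neg: "fps_exp c oo - fps_X = fps_exp (- c)" for c :: complex
    using fps_exp_compose_linear[of c "-1"]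
    by (simp only: fps_const_neg [symmetric] fps_const_1_eq_1) simp
  have "?C oo - fps_X = ?C"
    by (simp add: fps_compose_add_distrib neg add.commute)
  moreover have "(euler_gf (1 / 2) * ?C) oo - fps_X = fps_const 2"
    by (simp only: euler_gf_half_times_cosh fps_const_compose)
  ultimately have "(euler_gf (1 / 2) oo - fps_X) * ?C = euler_gf (1 / 2) * ?C"
    using euler_gf_half_times_cosh by (simp add: fps_compose_mult_distrib)
  moreover have "?C \<noteq> 0"
    using euler_gf_half_times_cosh by (metis fps_const_eq_0_iff mult_zero_right zero_neq_numeral)
  ultimately have "euler_gf (1 / 2) oo - fps_X = euler_gf (1 / 2)"
    by simp
  then have "(- 1) ^ j * fps_nth (euler_gf (1 / 2)) j = fps_nth (euler_gf (1 / 2)) j"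
    by (metis fps_compose_uminus' fps_nth_Abs_fps)
  then show ?thesis
    using assms by (simp add: poly_euler_poly)
qed

lemma euler_poly_half_0: "poly (euler_poly 0) (1 / 2) = 1"
  using arg_cong[OF euler_gf_half_times_cosh, of "\<lambda>F. fps_nth F 0"]
  by (simp add: poly_euler_poly)

lemma euler_poly_half_2: "poly (euler_poly 2) (1 / 2) = - 1 / 4"
proof -
  have "fps_nth (euler_gf (1 / 2)) 0 = 1" "fps_nth (euler_gf (1 / 2)) 1 = 0"
    using euler_poly_half_0 euler_poly_half_odd[of 1] by (simp_all add: poly_euler_poly)
  \<comment> \<open>With c_i the coefficients of the series at 1/2, the coefficient of t^2 in the
    product gives 2 c_2 + c_0 / 4 = 0, here up to a scalar.\<close>
  then have "16 * (1 + 8 * fps_nth (euler_gf (1 / 2)) 2) = 0"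
    using arg_cong[OF euler_gf_half_times_cosh, of "\<lambda>F. fps_nth F 2"]
    by (simp add: fps_mult_nth numeral_2_eq_2 field_simps)
  then have "8 * fps_nth (euler_gf (1 / 2)) 2 = - 1"
    by (simp only: mult_eq_0_iff add_eq_0_iff) simp
  then show ?thesis
    by (simp add: poly_euler_poly field_simps)
qed

lemma coeff_centred_euler_poly_high:
  "coeff (centred_euler_poly k) k = 1"
  "k \<ge> 1 \<Longrightarrow> coeff (centred_euler_poly k) (k - 1) = 0"
  "k \<ge> 2 \<Longrightarrow> coeff (centred_euler_poly k) (k - 2) = - of_nat (k choose 2) / 4"
  using binomial_symmetric[of 2 k]
  by (simp_all add: coeff_centred_euler_poly euler_poly_half_0 euler_poly_half_2
      euler_poly_half_odd)

lemma degree_centred_euler_poly: "degree (centred_euler_poly k) = k"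
proof (rule antisym)
  show "degree (centred_euler_poly k) \<le> k"
    by (rule degree_le) (simp add: coeff_centred_euler_poly)
  show "k \<le> degree (centred_euler_poly k)"
    by (rule le_degree) (simp add: coeff_centred_euler_poly_high)
qed

lemma degree_euler_poly: "degree (euler_poly k) = k"
  using degree_centred_euler_poly[of k] by (simp add: centred_euler_poly_def degree_pcompose)

lemma pcompose_centred_euler_poly: "pcompose (centred_euler_poly k) [:- 1 / 2, 1:] = euler_poly k"
  by (simp add: centred_euler_poly_def pcompose_assoc [symmetric] pcompose_pCons)

lemma centred_euler_poly_even: "centred_euler_poly (2 * m) = pcompose (euler_tilde m) [:0, 0, 1:]"
proof -
  have "poly (centred_euler_poly (2 * m)) y = poly (pcompose (euler_tilde m) [:0, 0, 1:]) y" for y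
  proof -
    let ?a = "\<lambda>i. of_nat (2 * m choose i) * poly (euler_poly (2 * m - i)) (1 / 2) * y ^ i"
    have "poly (centred_euler_poly (2 * m)) y = (\<Sum>i\<le>2 * m. ?a i)"
      by (simp add: centred_euler_poly_eq poly_sum poly_monom)
    \<comment> \<open>For odd \<open>i\<close> the index \<open>2 * m - i\<close> is odd too and the
      term vanishes; the even exponents are listed as \<open>2 * (m - j)\<close> to match
      \<open>euler_tilde\<close>.\<close>
    also have "\<dots> = (\<Sum>i\<in>(\<lambda>j. 2 * (m - j)) ` {..m}. ?a i)"
    proof (rule sum.mono_neutral_right)
      show "\<forall>i\<in>{..2 * m} - (\<lambda>j. 2 * (m - j)) ` {..m}. ?a i = 0"
      proof
        fix i assume i: "i \<in> {..2 * m} - (\<lambda>j. 2 * (m - j)) ` {..m}"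
        have "odd i"
        proof
          assume "even i"
          then obtain l where "i = 2 * l" by blast
          with i have "i = 2 * (m - (m - l))" "m - l \<le> m" by auto
          with i show False by blast
        qed
        with i show "?a i = 0"
          by (simp add: euler_poly_half_odd)
      qed
    qed auto
    also have "\<dots> = (\<Sum>j\<le>m. ?a (2 * (m - j)))"
      by (subst sum.reindex) (auto simp: inj_on_def)
    also have "\<dots> = (\<Sum>j\<le>m. of_nat (2 * m choose (2 * j)) * (euler_number (2 * j) / 4 ^ j)
        * (y\<^sup>2) ^ (m - j))"
    proof (rule sum.cong)
      fix j assume "j \<in> {..m}"
      then have j: "j \<le> m" by simp
      then have "2 * m choose (2 * (m - j)) = 2 * m choose (2 * j)" "2 * m - 2 * (m - j) = 2 * j"
        using binomial_symmetric[of "2 * j" "2 * m"] by (auto simp: diff_mult_distrib2)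
      moreover have "(2 :: complex) ^ (2 * j) = 4 ^ j"
        by (simp add: power_mult)
      ultimately show "?a (2 * (m - j)) = of_nat (2 * m choose (2 * j)) *
          (euler_number (2 * j) / 4 ^ j) * (y\<^sup>2) ^ (m - j)"
        by (simp only: euler_number_def power_mult [symmetric]) simp
    qed simp
    also have "\<dots> = poly (pcompose (euler_tilde m) [:0, 0, 1:]) y"
      by (simp add: euler_tilde_def poly_pcompose poly_sum poly_monom atLeast0AtMost
          power2_eq_square)
    finally show ?thesis .
  qed
  then show ?thesis
    by (simp add: poly_eq_poly_eq_iff [symmetric] fun_eq_iff)
qed

lemma euler_poly_even: "euler_poly (2 * m) = pcompose (euler_tilde m) ([:- 1 / 2, 1:] ^ 2)"
proof -
  have "pcompose [:0, 0, 1:] [:- 1 / 2, 1:] = ([:- 1 / 2, 1:] ^ 2 :: complex poly)"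
    by (simp add: pcompose_pCons power2_eq_square)
  then show ?thesis
    by (metis centred_euler_poly_even pcompose_assoc pcompose_centred_euler_poly)
qed

section \<open>Decompositions\<close>

lemma centred_euler_poly_no_decomposition:
  assumes f: "centred_euler_poly k = pcompose g h"
    and g: "degree g \<ge> 2" and h: "degree h \<ge> 3"
  shows False
proof -
  define n where "n = degree g"
  \<comment> \<open>Here \<open>d\<close> is the degree of \<open>h\<close> minus 3, so that the
    indices \<open>d\<close>, \<open>d + 1\<close>, \<open>d + 2\<close> involve no truncated
    subtraction.\<close>
  obtain d where d: "degree h = d + 3"
    using h by (metis add.commute le_Suc_ex)
  define D where "D = pcompose h [:1, 1:] - pcompose h [:-1, 1:]"
  define a where "a = lead_coeff h"
  define b where "b = lead_coeff g"
  have a: "a \<noteq> 0"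
    using h by (auto simp: a_def)
  have k: "k = n * (d + 3)"
    using arg_cong[OF f, of degree] by (simp add: degree_centred_euler_poly degree_pcompose d n_def)
  have n2: "n \<ge> 2" using g n_def by simp
  have "n * (d + 3) = (n - 1) * (d + 3) + (d + 3)"
    using n2 by (metis add.commute le_add_diff_inverse mult_Suc one_le_numeral order_trans plus_1_eq_Suc)
  \<comment> \<open>As \<open>i\<close> is less than \<open>degree h\<close>, the index
    \<open>k - i\<close> exceeds \<open>(n - 1) * degree h\<close>.\<close>
  then have top: "coeff (centred_euler_poly k) (k - i) = b * coeff (h ^ n) (n * degree h - i)"
    if "i \<le> 2" for i
    unfolding f using that
    by (simp add: k b_def d n_def coeff_pcompose_high)
  have "k \<ge> 2"
    using mult_le_mono[OF n2, of 1 "d + 3"] by (simp add: k)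
  have ba: "b * a ^ n = 1"
  proof -
    have "h \<noteq> 0"
      using h by auto
    then have "coeff (h ^ n) (n * degree h) = a ^ n"
      by (metis a_def degree_power_eq lead_coeff_power)
    then show ?thesis
      using top[of 0] by (simp add: coeff_centred_euler_poly_high)
  qed
  have ba': "b * a ^ (n - 1) * a = 1"
    using ba n2 power_minus_mult[of n a] by (simp add: mult.assoc)
  have h1: "coeff h (d + 2) = 0"
  proof -
    have "b * (of_nat n * a ^ (n - 1) * coeff h (d + 2)) = 0"
      using top[of 1] coeff_power_high(1)[of h n] coeff_centred_euler_poly_high(2)[of k] h n2
        \<open>k \<ge> 2\<close>
      by (simp add: a_def d)
    then show ?thesis
      using ba' n2 by auto
  qed
  \<comment> \<open>Comparing coefficients at \<open>k - 2\<close> and multiplying by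
    \<open>a\<close> lets \<open>ba'\<close> remove \<open>b * a ^ (n - 1) * a\<close>; then
    \<open>k = n * (d + 3)\<close> is put into \<open>k choose 2\<close> and the factor
    \<open>n\<close> cancels.\<close>
  have h2: "coeff h (d + 1) = - a * of_real ((real d + 3) * (real n * (real d + 3) - 1) / 8)"
  proof -
    have "b * (of_nat n * a ^ (n - 1) * coeff h (d + 1)) = - of_nat (k choose 2) / 4"
      using top[of 2] coeff_power_high(2)[of h n] h h1 n2 \<open>k \<ge> 2\<close>
      by (simp add: coeff_centred_euler_poly_high a_def d)
    then have "(b * a ^ (n - 1) * a) * (of_nat n * coeff h (d + 1)) =
        a * (- of_nat (k choose 2) / 4)"
      by (simp add: mult_ac)
    moreover have "of_nat (k choose 2) =
        (of_nat n * of_real ((real d + 3) * (real n * (real d + 3) - 1) / 2) :: complex)"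
    proof -
      obtain j where j: "k = j + 2"
        using \<open>k \<ge> 2\<close> by (metis add.commute le_Suc_ex)
      have "real (k choose 2) = real k * (real k - 1) / 2"
        unfolding j by (subst binomial_fact) (simp_all add: numeral_2_eq_2 field_simps)
      then have "real (k choose 2) = real n * ((real d + 3) * (real n * (real d + 3) - 1) / 2)"
        by (simp add: k)
      then show ?thesis
        by (metis of_real_mult of_real_of_nat_eq)
    qed
    ultimately have "of_nat n * coeff h (d + 1) =
        a * (- (of_nat n * of_real ((real d + 3) * (real n * (real d + 3) - 1) / 2)) / 4)"
      unfolding ba' by (simp only: mult_1_left)
    also have "\<dots> = of_nat n * (- a * of_real ((real d + 3) * (real n * (real d + 3) - 1) / 8))"
      by simp
    finally show ?thesis
      using n2 by (subst (asm) mult_cancel_left) auto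
  qed
  note D = coeff_central_difference[OF d h1, folded D_def a_def]
  have "coeff D (d + 2) \<noteq> 0"
    using a unfolding D(2) by (simp del: of_nat_add)
  then have degD: "degree D = d + 2"
    using D(1) by (intro antisym degree_le le_degree) auto
  have "Re z = 0" if "poly D z = 0" for z
  proof -
    have "poly h (z + 1) = poly h (z - 1)"
      using that by (simp add: D_def poly_pcompose add.commute)
    then have "poly (euler_poly k) (z + 1 + 1 / 2) = poly (euler_poly k) (z - 1 + 1 / 2)"
      by (simp only: poly_centred_euler_poly [symmetric] f poly_pcompose)
    \<comment> \<open>The functional equations at \<open>z + 1 / 2\<close> and
      \<open>z - 1 / 2\<close> share the value of the Euler polynomial at \<open>z + 1 / 2\<close>,
      and their other values agree by the previous line.\<close>
    then have "(z + 1 / 2) ^ k = (z - 1 / 2) ^ k"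
      using euler_poly_functional_equation[of k "z + 1 / 2"]
        euler_poly_functional_equation[of k "z - 1 / 2"]
      by (simp add: algebra_simps)
    then have "cmod (z + 1 / 2) ^ k = cmod (z - 1 / 2) ^ k"
      by (metis norm_power)
    \<comment> \<open>So \<open>z\<close> is equidistant from -1/2 and 1/2, which describes the
      imaginary axis.\<close>
    then have "cmod (z + 1 / 2) = cmod (z - 1 / 2)"
      using \<open>k \<ge> 2\<close> by (simp add: power_eq_iff_eq_base)
    then have "(cmod (z + 1 / 2))\<^sup>2 = (cmod (z - 1 / 2))\<^sup>2"
      by simp
    then show ?thesis
      unfolding cmod_power2 by (simp add: power2_eq_square algebra_simps)
  qed
  then obtain t where t: "t \<ge> 0" "coeff D d = coeff D (d + 2) * of_real t"
    using third_coeff_imaginary_roots[of D] D(3) degD by auto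
  \<comment> \<open>Both expressions for \<open>coeff D d\<close> are real multiples of
    \<open>a\<close>; cancelling \<open>a\<close> leaves a real equation whose sign can be
    examined.\<close>
  have "a * of_real (2 * (real d + 3) * t) = a * of_real (2 * real ((d + 3) choose 3)
      - 2 * (real d + 1) * ((real d + 3) * (real n * (real d + 3) - 1) / 8))"
    using t(2) unfolding D(2,4) h2 by (simp add: field_simps)
  then have "2 * (real d + 3) * t = 2 * real ((d + 3) choose 3)
      - 2 * (real d + 1) * ((real d + 3) * (real n * (real d + 3) - 1) / 8)"
    using a by (simp only: mult_cancel_left of_real_eq_iff) simp
  moreover have "real ((d + 3) choose 3) = (real d + 3) * (real d + 2) * (real d + 1) / 6"
    by (subst binomial_fact) (simp_all add: numeral_3_eq_3 field_simps)
  ultimately have "(real d + 3) * (2 * t) =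
      (real d + 3) * ((real d + 1) * ((real d + 2) / 3 - (real n * (real d + 3) - 1) / 4))"
    by (simp add: field_simps)
  then have "2 * t = (real d + 1) * ((real d + 2) / 3 - (real n * (real d + 3) - 1) / 4)"
    by (subst (asm) mult_cancel_left) auto
  \<comment> \<open>With \<open>n\<close> at least 2, the second factor is at most (d + 2)/3 - (2d +
    5)/4 = -(2d + 7)/12, contradicting \<open>t \<ge> 0\<close>.\<close>
  moreover have "2 * (real d + 3) \<le> real n * (real d + 3)"
    using n2 by (intro mult_right_mono) auto
  then have "(real d + 2) / 3 - (real n * (real d + 3) - 1) / 4 < 0"
    by (simp add: field_simps)
  then have "(real d + 1) * ((real d + 2) / 3 - (real n * (real d + 3) - 1) / 4) < 0"
    by (intro mult_pos_neg) auto
  ultimately show False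
    using t(1) by simp
qed

section \<open>Consequences for Euler polynomials and their even parts\<close>

lemma euler_poly_decomposition_degree:
  assumes "nontrivial_decomposition (euler_poly k) g h"
  shows "degree h = 2"
proof (rule ccontr)
  assume "degree h \<noteq> 2"
  have "centred_euler_poly k = pcompose g (pcompose h [:1 / 2, 1:])"
    using assms
    by (simp add: centred_euler_poly_def nontrivial_decomposition_def is_decomposition_def
        pcompose_assoc)
  moreover have "degree (pcompose h [:1 / 2, 1:]) \<ge> 3"
    using assms \<open>degree h \<noteq> 2\<close> by (simp add: nontrivial_decomposition_def degree_pcompose)
  ultimately show False
    using assms centred_euler_poly_no_decomposition unfolding nontrivial_decomposition_def by blast
qed

text \<open>An inner factor of degree 2 would make \<open>k\<close> even. The case
  \<open>k = 1\<close> is excluded because a linear polynomial is not indecomposable by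
  definition.\<close>

lemma euler_poly_odd_indecomposable:
  assumes "odd k" and "k \<noteq> 1"
  shows "indecomposable (euler_poly k)"
proof -
  have "k \<ge> 2"
    using assms by (cases "k = 0") auto
  moreover have False if decomp: "nontrivial_decomposition (euler_poly k) g h" for g h
  proof -
    have "k = degree g * degree h"
      using decomp degree_euler_poly[of k]
      by (simp add: nontrivial_decomposition_def is_decomposition_def degree_pcompose)
    then show False
      using euler_poly_decomposition_degree[OF decomp] assms(1) by simp
  qed
  ultimately show ?thesis
    by (auto simp: indecomposable_def degree_euler_poly)
qed

lemma euler_poly_even_decomposition:
  assumes decomp: "nontrivial_decomposition (euler_poly (2 * m)) g h"
  shows "equivalent_decompositions (g, h) (euler_tilde m, [:- 1 / 2, 1:] ^ 2)"
proof -
  define H where "H = pcompose h [:1 / 2, 1:]"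
  define n where "n = degree g"
  have E: "euler_poly (2 * m) = pcompose g h" and n2: "n \<ge> 2"
    using decomp by (simp_all add: nontrivial_decomposition_def is_decomposition_def n_def)
  have degH: "degree H = 2"
    using euler_poly_decomposition_degree[OF decomp] by (simp add: H_def degree_pcompose)
  have f: "centred_euler_poly (2 * m) = pcompose g H"
    by (simp add: centred_euler_poly_def E H_def pcompose_assoc)
  have m: "2 * m = n * 2"
    using arg_cong[OF f, of degree] degH
    by (simp add: degree_centred_euler_poly degree_pcompose n_def)
  \<comment> \<open>The vanishing second coefficient forces the quadratic \<open>H\<close> to have
    no linear term.\<close>
  have "coeff (centred_euler_poly (2 * m)) (n * 2 - 1) = lead_coeff g * coeff (H ^ n) (n * 2 - 1)"
    unfolding f n_def using n2 degH by (intro coeff_pcompose_high) (simp add: n_def)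
  also have "coeff (H ^ n) (n * 2 - 1) = of_nat n * lead_coeff H ^ (n - 1) * coeff H 1"
    using coeff_power_high(1)[of H n] degH n2 by simp
  also have "coeff (centred_euler_poly (2 * m)) (n * 2 - 1) = 0"
    using coeff_centred_euler_poly_high(2)[of "2 * m"] m n2 by (simp only: m)
  finally have "lead_coeff g * (of_nat n * lead_coeff H ^ (n - 1) * coeff H 1) = 0"
    by simp
  moreover have "g \<noteq> 0" "H \<noteq> 0"
    using n2 degH by (auto simp: n_def)
  ultimately have H1: "coeff H 1 = 0"
    using n2 by auto
  \<comment> \<open>Then H(y) = l(y^2), and undoing the shift gives h(x) = l((x - 1/2)^2), so
    \<open>l\<close> witnesses the equivalence.\<close>
  define l where "l = [:coeff H 0, coeff H 2:]"
  have degl: "degree l = 1"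
    using leading_coeff_neq_0[OF \<open>H \<noteq> 0\<close>] degH by (simp add: l_def)
  have "H = [:coeff H 0, coeff H 1, coeff H 2:]"
    using degH by (intro poly_eqI) (auto simp: coeff_pCons coeff_eq_0 numeral_2_eq_2 split: nat.splits)
  then have "H = [:coeff H 0, 0, coeff H 2:]"
    by (simp only: H1)
  also have "\<dots> = pcompose l [:0, 0, 1:]"
    by (simp add: l_def pcompose_pCons)
  finally have "H = pcompose l [:0, 0, 1:]" .
  then have "pcompose H [:- 1 / 2, 1:] = pcompose l (pcompose [:0, 0, 1:] [:- 1 / 2, 1:])"
    by (simp only: pcompose_assoc)
  moreover have "pcompose H [:- 1 / 2, 1:] = h"
    by (simp add: H_def pcompose_assoc [symmetric] pcompose_pCons)
  ultimately have h: "h = pcompose l ([:- 1 / 2, 1:] ^ 2)"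
    by (simp add: pcompose_pCons power2_eq_square)
  have "euler_tilde m = pcompose g l"
  proof (rule pcompose_cancel_right)
    show "pcompose (euler_tilde m) ([:- 1 / 2, 1:] ^ 2) = pcompose (pcompose g l) ([:- 1 / 2, 1:] ^ 2)"
      using E by (simp only: euler_poly_even h pcompose_assoc)
    show "degree ([:- 1 / 2, 1:] ^ 2 :: complex poly) > 0"
      by (simp add: degree_linear_power)
  qed
  then show ?thesis
    using degl h by (auto simp: equivalent_decompositions_def)
qed

text \<open>A nontrivial decomposition with inner part \<open>u\<close> would give one of
  \<open>euler_poly (2 * m)\<close> with inner part \<open>pcompose u ?s\<close>, of degree at least
  4 instead of 2. The degree of \<open>euler_tilde m\<close> is \<open>m\<close>, hence the bound on
  \<open>m\<close>.\<close>

lemma euler_tilde_indecomposable: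
  assumes "m \<ge> 2"
  shows "indecomposable (euler_tilde m)"
proof -
  let ?s = "[:- 1 / 2, 1:] ^ 2 :: complex poly"
  have s: "degree ?s = 2"
    by (rule degree_linear_power)
  have "2 * m = degree (euler_tilde m) * 2"
    using arg_cong[OF euler_poly_even, of degree m] by (simp only: degree_euler_poly degree_pcompose s)
  then have "degree (euler_tilde m) \<ge> 2"
    using assms by simp
  moreover have False if decomp: "nontrivial_decomposition (euler_tilde m) g u" for g u
  proof -
    have "degree (pcompose u ?s) = degree u * 2"
      by (simp only: degree_pcompose s)
    then have deg: "degree (pcompose u ?s) \<ge> 4"
      using decomp by (simp add: nontrivial_decomposition_def)
    moreover have "euler_poly (2 * m) = pcompose g (pcompose u ?s)"
      using decomp
      by (simp only: nontrivial_decomposition_def is_decomposition_def euler_poly_even pcompose_assoc)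
    ultimately have "nontrivial_decomposition (euler_poly (2 * m)) g (pcompose u ?s)"
      using decomp unfolding nontrivial_decomposition_def is_decomposition_def by linarith
    then show False
      using euler_poly_decomposition_degree deg by fastforce
  qed
  ultimately show ?thesis
    by (auto simp: indecomposable_def)
qed

theorem theorem1p1:
  shows "(\<forall>k. odd k \<and> k \<noteq> 1 \<longrightarrow> indecomposable (euler_poly k)) \<and>
    (\<forall>k m. k = 2 * m \<longrightarrow>
       is_decomposition (euler_poly k) (euler_tilde m) ([:- 1 / 2, 1:] ^ 2) \<and>
       (\<forall>g h. nontrivial_decomposition (euler_poly k) g h \<longrightarrow>
          equivalent_decompositions (g, h) (euler_tilde m, [:- 1 / 2, 1:] ^ 2))) \<and>
    (\<forall>m\<ge>2. indecomposable (euler_tilde m))"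
  using euler_poly_odd_indecomposable euler_poly_even_decomposition euler_tilde_indecomposable
  by (auto simp only: is_decomposition_def euler_poly_even)

end
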